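(* Let $\mathfrak{a}\subset \mathbb{C}\langle X_1,\dots,X_n\rangle$ be a two-sided homogeneous ideal, and let $>$ be a term order on the free monoid $\langle X_1,\dots,X_n\rangle$. Then there are a monomial ideal $\mathfrak{b}\subset \mathbb{C}\langle X_1,\dots,X_n\rangle$ and an $F_\delta$-subset $U\subset \mathrm{GL}(V)$ such that $$g\in U \implies \mathrm{in}_>(g(\mathfrak{a}))=\mathfrak{b},$$ and such that if $\mathfrak{b}$ is finitely generated then $U$ is open.
   Context: $V$ is a complex vector space with basis $X_1,\dots,X_n$, and $T(V)$ is identified with the free associative algebra $\mathbb{C}\langle X_1,\dots,X_n\rangle$. $g=(g_{ij})\in\mathrm{GL}(V)$ acts on it by the algebra automorphism with $g(X_i)=\sum_{\ell=1}^n g_{\ell,i}X_\ell$. $\mathrm{GL}(V)$ carries the Zariski topology. An $F_\delta$-subset of $\mathrm{GL}(V)$ means (in this paper's terminology) a countable intersection of non-empty Zariski-open subsets; such subsets are non-empty and dense. A term order on the free monoid is a total well-order compatible with left and right multiplication. A monomial (monoid) ideal is a two-sided ideal generated by words. $\mathrm{in}_>(\mathfrak{c})$ is the two-sided ideal generated by the largest words of the nonzero elements of $\mathfrak{c}$. Finitely generated means finitely generated as a two-sided ideal. *)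

theory Defs
  imports "HOL-Analysis.Analysis" "HOL-Library.Poly_Mapping"
begin

section \<open>The free associative algebra\<close>

text \<open>Words in the generators are lists. Making lists an (additively written) monoid under
  concatenation turns the finitely supported functions from words to complex numbers, with the
  convolution product of \<^theory>\<open>HOL-Library.Poly_Mapping\<close>, into the free associative algebra.\<close>

instantiation list :: (type) monoid_add
begin

definition zero_list :: "'a list" where "zero_list = []"

definition plus_list :: "'a list \<Rightarrow> 'a list \<Rightarrow> 'a list" where "plus_list = (@)"

instance by standard (simp_all add: zero_list_def plus_list_def)

end

type_synonym 'n free_alg = "'n list \<Rightarrow>\<^sub>0 complex"

definition word :: "'n list \<Rightarrow> 'n free_alg"
  where "word w = Poly_Mapping.single w 1"

definition scalar :: "complex \<Rightarrow> 'n free_alg"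
  where "scalar c = Poly_Mapping.single [] c"

definition two_sided_ideal :: "'a::ring_1 set \<Rightarrow> bool"
  where "two_sided_ideal I \<longleftrightarrow>
    0 \<in> I \<and> (\<forall>x\<in>I. \<forall>y\<in>I. x + y \<in> I) \<and> (\<forall>x\<in>I. \<forall>r. r * x \<in> I \<and> x * r \<in> I)"

text \<open>The two-sided ideal generated by \<open>S\<close> is \<open>two_sided_ideal hull S\<close>; it is an ideal
  because ideals are closed under intersection.\<close>

lemma two_sided_ideal_hull: "two_sided_ideal (two_sided_ideal hull S)"
  by (rule hull_in) (simp add: two_sided_ideal_def)

definition homogeneous :: "'n free_alg \<Rightarrow> bool"
  where "homogeneous f \<longleftrightarrow> (\<exists>d. \<forall>w\<in>Poly_Mapping.keys f. length w = d)"

definition homogeneous_ideal :: "'n free_alg set \<Rightarrow> bool"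
  where "homogeneous_ideal I \<longleftrightarrow> (\<exists>S. (\<forall>f\<in>S. homogeneous f) \<and> I = two_sided_ideal hull S)"

definition monomial_ideal :: "'n free_alg set \<Rightarrow> bool"
  where "monomial_ideal I \<longleftrightarrow> (\<exists>W. I = two_sided_ideal hull (word ` W))"

definition fin_gen_ideal :: "'a::ring_1 set \<Rightarrow> bool"
  where "fin_gen_ideal I \<longleftrightarrow> (\<exists>S. finite S \<and> I = two_sided_ideal hull S)"


section \<open>Term orders and initial ideals\<close>

text \<open>An order is given by its reflexive relation: \<open>(u, v) \<in> r\<close> means \<open>u \<le> v\<close>.\<close>

definition term_order :: "('n list \<times> 'n list) set \<Rightarrow> bool"
  where "term_order r \<longleftrightarrow> well_order_on UNIV r \<and>
    (\<forall>u v x y. (u, v) \<in> r \<longrightarrow> (x @ u @ y, x @ v @ y) \<in> r)"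

definition lead_word :: "('n list \<times> 'n list) set \<Rightarrow> 'n free_alg \<Rightarrow> 'n list"
  where "lead_word r f =
    (THE w. w \<in> Poly_Mapping.keys f \<and> (\<forall>v\<in>Poly_Mapping.keys f. (v, w) \<in> r))"

definition initial_ideal :: "('n list \<times> 'n list) set \<Rightarrow> 'n free_alg set \<Rightarrow> 'n free_alg set"
  where "initial_ideal r I = two_sided_ideal hull {word (lead_word r f) |f. f \<in> I \<and> f \<noteq> 0}"


section \<open>The action of the general linear group\<close>

definition gl_gen :: "complex^'n^'n \<Rightarrow> 'n \<Rightarrow> 'n::finite free_alg"
  where "gl_gen g i = (\<Sum>l\<in>UNIV. scalar (g $ l $ i) * word [l])"

definition gl_act :: "complex^'n^'n \<Rightarrow> 'n free_alg \<Rightarrow> 'n::finite free_alg"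
  where "gl_act g f = (\<Sum>w\<in>Poly_Mapping.keys f.
    scalar (Poly_Mapping.lookup f w) * prod_list (List.map (gl_gen g) w))"

text \<open>\<open>gl_act g\<close> is the homomorphism of complex algebras sending each generator \<open>word [i]\<close> to
  \<open>gl_gen g i\<close>.\<close>

lemma scalar_0 [simp]: "scalar 0 = 0"
  by (simp add: scalar_def)

lemma scalar_1 [simp]: "scalar 1 = 1"
  by (simp add: scalar_def flip: zero_list_def)

lemma scalar_add: "scalar (a + b) = scalar a + scalar b"
  by (simp add: scalar_def single_add)

lemma scalar_mult: "scalar (a * b) = scalar a * scalar b"
  by (simp add: scalar_def mult_single flip: zero_list_def)

lemma free_alg_sum_words:
  fixes f :: "'n free_alg"
  assumes "finite A" "Poly_Mapping.keys f \<subseteq> A"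
  shows "f = (\<Sum>w\<in>A. Poly_Mapping.single w (Poly_Mapping.lookup f w))"
proof (rule poly_mapping_eqI)
  fix k
  show "Poly_Mapping.lookup f k =
      Poly_Mapping.lookup (\<Sum>w\<in>A. Poly_Mapping.single w (Poly_Mapping.lookup f w)) k"
    using assms
    by (auto simp: lookup_sum lookup_single when_def in_keys_iff)
qed

lemma scalar_central: "scalar c * f = f * scalar c"
proof -
  have "scalar c * (\<Sum>w\<in>A. Poly_Mapping.single w (h w)) =
      (\<Sum>w\<in>A. Poly_Mapping.single w (h w)) * scalar c" for A and h :: "'a list \<Rightarrow> complex"
    by (simp add: scalar_def sum_distrib_left sum_distrib_right mult_single mult.commute
        flip: zero_list_def)
  from this[of "Poly_Mapping.lookup f" "Poly_Mapping.keys f"] show ?thesis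
    by (simp only: free_alg_sum_words[OF finite_keys order_refl, symmetric])
qed

lemma gl_act_superset:
  assumes "finite A" "Poly_Mapping.keys f \<subseteq> A"
  shows "gl_act g f =
    (\<Sum>w\<in>A. scalar (Poly_Mapping.lookup f w) * prod_list (List.map (gl_gen g) w))"
  unfolding gl_act_def using assms
  by (intro sum.mono_neutral_left) (auto simp: in_keys_iff)

lemma gl_act_0 [simp]: "gl_act g 0 = 0"
  by (simp add: gl_act_def)

lemma gl_act_add: "gl_act g (p + q) = gl_act g p + gl_act g q"
proof -
  let ?A = "Poly_Mapping.keys p \<union> Poly_Mapping.keys q"
  have "Poly_Mapping.keys (p + q) \<subseteq> ?A"
    by (rule Poly_Mapping.keys_add)
  then show ?thesis
    using gl_act_superset[of ?A "p + q" g] gl_act_superset[of ?A p g] gl_act_superset[of ?A q g]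
    by (simp add: lookup_add scalar_add ring_distribs sum.distrib)
qed

lemma gl_act_sum: "gl_act g (\<Sum>i\<in>A. p i) = (\<Sum>i\<in>A. gl_act g (p i))"
  by (induction A rule: infinite_finite_induct) (simp_all add: gl_act_add)

lemma gl_act_single:
  "gl_act g (Poly_Mapping.single w c) = scalar c * prod_list (List.map (gl_gen g) w)"
  by (simp add: gl_act_def)

lemma gl_act_scalar: "gl_act g (scalar c) = scalar c"
  by (simp add: scalar_def[of c] gl_act_single)

lemma gl_act_1: "gl_act g 1 = 1"
  using gl_act_scalar[of g 1] by simp

lemma gl_act_word_single: "gl_act g (word [i]) = gl_gen g i"
  by (simp add: word_def gl_act_single)

lemma gl_act_mult: "gl_act g (p * q) = gl_act g p * gl_act g q"
proof -
  let ?s = "\<lambda>w c. Poly_Mapping.single w c"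
  have single: "gl_act g (?s u a * ?s v b) = gl_act g (?s u a) * gl_act g (?s v b)" for u v a b
  proof -
    let ?U = "prod_list (List.map (gl_gen g) u)" and ?V = "prod_list (List.map (gl_gen g) v)"
    have "gl_act g (?s u a * ?s v b) = scalar a * (scalar b * ?U) * ?V"
      by (simp add: mult_single gl_act_single plus_list_def scalar_mult mult.assoc)
    also have "\<dots> = scalar a * (?U * scalar b) * ?V"
      by (simp only: scalar_central[of b])
    finally show ?thesis
      by (simp add: gl_act_single mult.assoc)
  qed
  have sums: "gl_act g ((\<Sum>u\<in>A. ?s u (a u)) * (\<Sum>v\<in>B. ?s v (b v))) =
      gl_act g (\<Sum>u\<in>A. ?s u (a u)) * gl_act g (\<Sum>v\<in>B. ?s v (b v))" for A B a b
    by (simp add: sum_product gl_act_sum single)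
  from this[of "Poly_Mapping.lookup p" "Poly_Mapping.keys p"
      "Poly_Mapping.lookup q" "Poly_Mapping.keys q"]
  show ?thesis
    by (simp only: free_alg_sum_words[OF finite_keys order_refl, symmetric])
qed


section \<open>The Zariski topology on the general linear group\<close>

inductive_set matrix_poly :: "(complex^'n^'n \<Rightarrow> complex) set"
  where
    const: "(\<lambda>g. c) \<in> matrix_poly"
  | entry: "(\<lambda>g. g $ i $ j) \<in> matrix_poly"
  | add: "p \<in> matrix_poly \<Longrightarrow> q \<in> matrix_poly \<Longrightarrow> (\<lambda>g. p g + q g) \<in> matrix_poly"
  | mult: "p \<in> matrix_poly \<Longrightarrow> q \<in> matrix_poly \<Longrightarrow> (\<lambda>g. p g * q g) \<in> matrix_poly"

definition zariski_closed :: "(complex^'n^'n) set \<Rightarrow> bool"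
  where "zariski_closed Z \<longleftrightarrow> (\<exists>P\<subseteq>matrix_poly. Z = {g. \<forall>p\<in>P. p g = 0})"

lemma zariski_closed_Un:
  assumes "zariski_closed Y" "zariski_closed Z"
  shows "zariski_closed (Y \<union> Z)"
proof -
  obtain P Q where P: "P \<subseteq> matrix_poly" "Y = {g. \<forall>p\<in>P. p g = 0}"
    and Q: "Q \<subseteq> matrix_poly" "Z = {g. \<forall>q\<in>Q. q g = 0}"
    using assms unfolding zariski_closed_def by blast
  have "Y \<union> Z = {g. \<forall>s\<in>{\<lambda>g. p g * q g |p q. p \<in> P \<and> q \<in> Q}. s g = 0}"
    unfolding P(2) Q(2) by fastforce
  moreover have "{\<lambda>g. p g * q g |p q. p \<in> P \<and> q \<in> Q} \<subseteq> matrix_poly"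
    using P(1) Q(1) by (auto intro: matrix_poly.mult)
  ultimately show ?thesis
    unfolding zariski_closed_def by blast
qed

lemma zariski_closed_Inter:
  assumes "\<And>Z. Z \<in> \<Z> \<Longrightarrow> zariski_closed Z"
  shows "zariski_closed (\<Inter>\<Z>)"
proof -
  have "\<forall>Z\<in>\<Z>. \<exists>P\<subseteq>matrix_poly. Z = {g. \<forall>p\<in>P. p g = 0}"
    using assms unfolding zariski_closed_def by blast
  then have "\<exists>P. \<forall>Z\<in>\<Z>. P Z \<subseteq> matrix_poly \<and> Z = {g. \<forall>p\<in>P Z. p g = 0}"
    by (intro bchoice) auto
  then obtain P where P: "\<forall>Z\<in>\<Z>. P Z \<subseteq> matrix_poly \<and> Z = {g. \<forall>p\<in>P Z. p g = 0}" ..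
  have "g \<in> \<Inter>\<Z> \<longleftrightarrow> (\<forall>p\<in>(\<Union>Z\<in>\<Z>. P Z). p g = 0)" for g
  proof -
    have "g \<in> Z \<longleftrightarrow> (\<forall>p\<in>P Z. p g = 0)" if "Z \<in> \<Z>" for Z
      using P[rule_format, OF that, THEN conjunct2, THEN eqset_imp_iff, of g] by simp
    then show ?thesis
      by auto
  qed
  then have "\<Inter>\<Z> = {g. \<forall>p\<in>(\<Union>Z\<in>\<Z>. P Z). p g = 0}"
    by blast
  moreover have "(\<Union>Z\<in>\<Z>. P Z) \<subseteq> matrix_poly"
    using P by blast
  ultimately show ?thesis
    unfolding zariski_closed_def by blast
qed

definition zariski :: "(complex^'n^'n) topology"
  where "zariski = topology (\<lambda>U. zariski_closed (- U))"

lemma openin_zariski: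
  fixes U :: "(complex^'n^'n) set"
  shows "openin zariski U \<longleftrightarrow> zariski_closed (- U)"
proof -
  have "istopology (\<lambda>U :: (complex^'n^'n) set. zariski_closed (- U))"
    unfolding istopology_def
  proof (intro conjI allI impI)
    fix S T :: "(complex^'n^'n) set"
    assume "zariski_closed (- S)" "zariski_closed (- T)"
    then show "zariski_closed (- (S \<inter> T))"
      by (simp add: Compl_Int zariski_closed_Un)
  next
    fix K :: "(complex^'n^'n) set set"
    assume K: "\<forall>U\<in>K. zariski_closed (- U)"
    have "- \<Union>K = \<Inter>(uminus ` K)"
      by blast
    then show "zariski_closed (- \<Union>K)"
      using K by (auto intro: zariski_closed_Inter)
  qed
  then show ?thesis
    by (simp add: zariski_def topology_inverse')
qed

definition zariski_GL :: "(complex^'n^'n) topology"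
  where "zariski_GL = subtopology zariski {g. invertible g}"

text \<open>This is not the usual topological notion: the open sets are required to be non-empty.\<close>

definition F_delta :: "(complex^'n^'n) set \<Rightarrow> bool"
  where "F_delta U \<longleftrightarrow>
    (\<exists>W :: nat \<Rightarrow> (complex^'n^'n) set.
      (\<forall>k. openin zariski_GL (W k) \<and> W k \<noteq> {}) \<and> U = (\<Inter>k. W k))"

end

theory Submission
  imports Defs
begin

text \<open>A homogeneous ideal \<open>I\<close> is the direct sum of its parts \<open>I\<^sub>d\<close> of degree \<open>d\<close>, a matrix \<open>g\<close>
  maps words of length \<open>d\<close> to combinations of words of length \<open>d\<close>, and there are only finitely
  many of those. Everything is therefore decided one degree at a time, by finite-dimensional linear
  algebra over polynomial functions of \<open>g\<close>.

  In degree \<open>d\<close>, consider the functions \<open>m\<close> of a matrix whose value \<open>m g\<close> lies in \<open>g(I\<^sub>d)\<close> and whose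
  coefficients are polynomials in the entries of \<open>g\<close>. The largest word \<open>w\<close> whose coefficient in \<open>m\<close>
  is not the zero polynomial is the leading word of \<open>m g\<close> for every \<open>g\<close> at which that coefficient
  does not vanish. Let \<open>B\<close> be the set of all these generic leading words, over all degrees, and choose
  for each \<open>w \<in> B\<close> one such \<open>m\<close>, with coefficient \<open>c\<^sub>w\<close> at \<open>w\<close>. If \<open>h\<close> is a matrix
  where no \<open>c\<^sub>w\<close> with \<open>w\<close> of length \<open>d\<close> vanishes, then the leading words of \<open>h(I\<^sub>d)\<close> are exactly the
  words of length \<open>d\<close> in \<open>B\<close>: Gaussian elimination over the polynomial functions rewrites any element
  of \<open>h(I\<^sub>d)\<close> until its leading word is generic (\<open>lead_words_at_generic_point\<close>). An invertible such
  \<open>h\<close> exists because finitely many non-zero polynomials have a common non-zero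
  (\<open>finitely_many_matrix_polys_nonzero\<close>).

  The number of leading words of \<open>g(I\<^sub>d)\<close> is the dimension of \<open>I\<^sub>d\<close>, the same for all invertible \<open>g\<close>
  (\<open>card_lead_words_le\<close>). So for an invertible \<open>g\<close> it suffices that the leading words of \<open>g(I)\<close>
  include \<open>B\<close>; equality is then forced by counting. As the leading words of an ideal are closed under
  multiplication, it even suffices that they include a set \<open>G \<subseteq> B\<close> of words generating the same
  monomial ideal \<open>\<bb>\<close> as \<open>B\<close>. Hence \<open>U\<close> can be taken to be the set of invertible \<open>g\<close> with
  \<open>c\<^sub>w g \<noteq> 0\<close> for all \<open>w \<in> G\<close>. It is a countable intersection of non-empty open sets, and it is open
  when \<open>G\<close> is finite, which is possible whenever \<open>\<bb>\<close> is finitely generated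
  (\<open>fin_gen_word_ideal\<close>).\<close>

section \<open>Multiplying by a single word\<close>

lemma lookup_single_times_append:
  fixes f :: "'n free_alg"
  shows "Poly_Mapping.lookup (Poly_Mapping.single u c * f) (u @ v) = c * Poly_Mapping.lookup f v"
proof -
  have "Poly_Mapping.lookup (Poly_Mapping.single u c *
      (\<Sum>w\<in>Poly_Mapping.keys f. Poly_Mapping.single w (Poly_Mapping.lookup f w))) (u @ v)
    = c * Poly_Mapping.lookup f v"
    by (simp add: sum_distrib_left mult_single plus_list_def lookup_sum lookup_single when_def
        in_keys_iff)
  then show ?thesis
    by (simp only: free_alg_sum_words[OF finite_keys order_refl, symmetric])
qed

lemma lookup_times_single_append:
  fixes f :: "'n free_alg"
  shows "Poly_Mapping.lookup (f * Poly_Mapping.single v c) (u @ v) = Poly_Mapping.lookup f u * c"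
proof -
  have "Poly_Mapping.lookup ((\<Sum>w\<in>Poly_Mapping.keys f.
      Poly_Mapping.single w (Poly_Mapping.lookup f w)) * Poly_Mapping.single v c) (u @ v)
    = Poly_Mapping.lookup f u * c"
    by (simp add: sum_distrib_right mult_single plus_list_def lookup_sum lookup_single when_def
        in_keys_iff)
  then show ?thesis
    by (simp only: free_alg_sum_words[OF finite_keys order_refl, symmetric])
qed

lemma keys_timesD:
  fixes f h :: "'n free_alg"
  assumes "w \<in> Poly_Mapping.keys (f * h)"
  obtains u v where "u \<in> Poly_Mapping.keys f" "v \<in> Poly_Mapping.keys h" "w = u @ v"
  using assms keys_mult[of f h] by (auto simp: plus_list_def)

lemma keys_single_timesD:
  fixes f :: "'n free_alg"
  assumes "w \<in> Poly_Mapping.keys (Poly_Mapping.single u c * f)"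
  obtains v where "v \<in> Poly_Mapping.keys f" "w = u @ v"
  using assms by (elim keys_timesD) (auto split: if_splits)

lemma lookup_scalar_times [simp]:
  "Poly_Mapping.lookup (scalar c * f) w = c * Poly_Mapping.lookup f w"
  using lookup_single_times_append[of "[]" c f w] by (simp add: scalar_def)

lemma lookup_gl_gen_times_Nil [simp]: "Poly_Mapping.lookup (gl_gen g i * f) [] = 0"
proof -
  have "Poly_Mapping.lookup (word [l] * f) [] = 0" for l
    using keys_single_timesD[of "[]" "[l]" 1 f] by (auto simp: word_def in_keys_iff)
  then show ?thesis
    by (simp add: gl_gen_def sum_distrib_right lookup_sum mult.assoc)
qed

lemma lookup_gl_gen_times_Cons [simp]:
  "Poly_Mapping.lookup (gl_gen g i * f) (l # v) = g $ l $ i * Poly_Mapping.lookup f v"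
proof -
  have *: "Poly_Mapping.lookup (word [k] * f) (l # v) = (if k = l then Poly_Mapping.lookup f v else 0)" for k
    using keys_single_timesD[of "l # v" "[k]" 1 f] lookup_single_times_append[of "[k]" 1 f v]
    by (auto simp: word_def in_keys_iff)
  have "Poly_Mapping.lookup (gl_gen g i * f) (l # v)
      = (\<Sum>k\<in>UNIV. Poly_Mapping.lookup (scalar (g $ k $ i) * (word [k] * f)) (l # v))"
    by (simp add: gl_gen_def sum_distrib_right lookup_sum mult.assoc)
  also have "\<dots> = (\<Sum>k\<in>UNIV. if k = l then g $ l $ i * Poly_Mapping.lookup f v else 0)"
    by (intro sum.cong refl) (simp add: *)
  finally show ?thesis by simp
qed


section \<open>Polynomial functions on matrices\<close>

lemma matrix_poly_sum:
  "(\<And>i. i \<in> A \<Longrightarrow> p i \<in> matrix_poly) \<Longrightarrow> (\<lambda>g. \<Sum>i\<in>A. p i g) \<in> matrix_poly"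
  by (induction A rule: infinite_finite_induct)
    (auto intro: matrix_poly.const matrix_poly.add)

lemma matrix_poly_prod:
  "(\<And>i. i \<in> A \<Longrightarrow> p i \<in> matrix_poly) \<Longrightarrow> (\<lambda>g. \<Prod>i\<in>A. p i g) \<in> matrix_poly"
  by (induction A rule: infinite_finite_induct)
    (auto intro: matrix_poly.const matrix_poly.mult)

lemma det_matrix_poly: "det \<in> matrix_poly"
  unfolding det_def[abs_def]
  by (intro matrix_poly_sum matrix_poly.mult matrix_poly.const matrix_poly_prod
      matrix_poly.entry)

text \<open>Restriction to lines transfers facts about polynomials in one variable to polynomial
  functions on matrices, without introducing polynomials in several variables.\<close>

lemma matrix_poly_on_line:
  assumes "p \<in> matrix_poly"
  shows "\<exists>P. \<forall>t. p (\<chi> i j. a $ i $ j + t * b $ i $ j) = poly P t"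
  using assms
proof induction
  case (const c)
  show ?case by (rule exI[of _ "[:c:]"]) simp
next
  case (entry i j)
  show ?case by (rule exI[of _ "[:a $ i $ j, b $ i $ j:]"]) simp
next
  case (add p q)
  then obtain P Q where "\<forall>t. p (\<chi> i j. a $ i $ j + t * b $ i $ j) = poly P t"
    "\<forall>t. q (\<chi> i j. a $ i $ j + t * b $ i $ j) = poly Q t" by blast
  then show ?case by (intro exI[of _ "P + Q"]) simp
next
  case (mult p q)
  then obtain P Q where "\<forall>t. p (\<chi> i j. a $ i $ j + t * b $ i $ j) = poly P t"
    "\<forall>t. q (\<chi> i j. a $ i $ j + t * b $ i $ j) = poly Q t" by blast
  then show ?case by (intro exI[of _ "P * Q"]) simp
qed

text \<open>Irreducibility of the matrix space: on the line through the two points neither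
  restricted polynomial is zero, so their product has only finitely many roots there.\<close>

lemma matrix_poly_mult_nonzero:
  fixes a b :: "complex^'n^'n"
  assumes "p \<in> matrix_poly" "q \<in> matrix_poly" "p a \<noteq> 0" "q b \<noteq> 0"
  shows "\<exists>g. p g \<noteq> 0 \<and> q g \<noteq> 0"
proof -
  define line where "line t = (\<chi> i j. a $ i $ j + t * (b - a) $ i $ j)" for t
  obtain P Q where P: "\<And>t. p (line t) = poly P t" and Q: "\<And>t. q (line t) = poly Q t"
    using matrix_poly_on_line[OF assms(1), of a "b - a"] matrix_poly_on_line[OF assms(2), of a "b - a"]
    unfolding line_def by blast
  have "line 0 = a" "line 1 = b"
    by (simp_all add: line_def vec_eq_iff)
  then have "poly P 0 \<noteq> 0" "poly Q 1 \<noteq> 0"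
    using P[of 0] Q[of 1] assms by simp_all
  then have "P * Q \<noteq> 0" by auto
  then obtain t where "poly (P * Q) t \<noteq> 0"
    using poly_all_0_iff_0 by blast
  then show ?thesis
    using P Q by (intro exI[of _ "line t"]) simp
qed

text \<open>The common non-zero can be found among the invertible matrices because the determinant
  is one more polynomial that is not identically zero.\<close>

lemma finitely_many_matrix_polys_nonzero:
  fixes p :: "'i \<Rightarrow> complex^'n^'n \<Rightarrow> complex"
  assumes "finite A" "\<And>i. i \<in> A \<Longrightarrow> p i \<in> matrix_poly" "\<And>i. i \<in> A \<Longrightarrow> \<exists>g. p i g \<noteq> 0"
  shows "\<exists>g. invertible g \<and> (\<forall>i\<in>A. p i g \<noteq> 0)"
proof -
  have "\<exists>g. (\<Prod>i\<in>A. p i g) \<noteq> 0"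
    using assms
  proof (induction A)
    case empty
    show ?case by simp
  next
    case (insert i A)
    obtain a where "p i a \<noteq> 0" using insert.prems by blast
    moreover obtain b where "(\<Prod>i\<in>A. p i b) \<noteq> 0" using insert by blast
    ultimately have "\<exists>g. p i g \<noteq> 0 \<and> (\<Prod>i\<in>A. p i g) \<noteq> 0"
      using insert by (intro matrix_poly_mult_nonzero matrix_poly_prod) auto
    then show ?case using insert by simp
  qed
  then obtain a where "(\<Prod>i\<in>A. p i a) \<noteq> 0" ..
  moreover have "det (mat 1 :: complex^'n^'n) \<noteq> 0" by simp
  ultimately have "\<exists>g. (\<Prod>i\<in>A. p i g) \<noteq> 0 \<and> det g \<noteq> 0"
    using assms(2) by (intro matrix_poly_mult_nonzero matrix_poly_prod det_matrix_poly)
  then show ?thesis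
    using assms(1) by (auto simp: invertible_det_nz)
qed

lemma openin_zariski_GL_nonzero:
  assumes "p \<in> matrix_poly"
  shows "openin zariski_GL {g. invertible g \<and> p g \<noteq> 0}"
proof -
  have "openin zariski {g. p g \<noteq> 0}"
    unfolding openin_zariski zariski_closed_def
    using assms by (intro exI[of _ "{p}"]) auto
  then show ?thesis
    unfolding zariski_GL_def openin_subtopology by (intro exI[of _ "{g. p g \<noteq> 0}"]) auto
qed


section \<open>The action of matrices\<close>

lemma lookup_gl_act:
  "Poly_Mapping.lookup (gl_act g f) v = (\<Sum>w\<in>Poly_Mapping.keys f.
    Poly_Mapping.lookup f w * Poly_Mapping.lookup (prod_list (map (gl_gen g) w)) v)"
  by (simp add: gl_act_def lookup_sum)

lemma gl_word_coeff_matrix_poly: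
  "(\<lambda>g. Poly_Mapping.lookup (prod_list (map (gl_gen g) w)) v) \<in> matrix_poly"
proof (induction w arbitrary: v)
  case Nil
  then show ?case by (simp add: matrix_poly.const)
next
  case (Cons i w)
  then show ?case
    by (cases v) (auto intro: matrix_poly.const matrix_poly.mult matrix_poly.entry)
qed

lemma gl_act_coeff_matrix_poly: "(\<lambda>g. Poly_Mapping.lookup (gl_act g f) v) \<in> matrix_poly"
  unfolding lookup_gl_act
  by (intro matrix_poly_sum matrix_poly.mult matrix_poly.const gl_word_coeff_matrix_poly)

lemma gl_word_coeff_length:
  "length v \<noteq> length w \<Longrightarrow> Poly_Mapping.lookup (prod_list (map (gl_gen g) w)) v = 0"
proof (induction w arbitrary: v)
  case Nil
  then show ?case by (simp add: one_poly_mapping.rep_eq zero_list_def)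
next
  case (Cons i w)
  then show ?case by (cases v) auto
qed

lemma gl_act_scalar_mult: "gl_act g (scalar c * f) = scalar c * gl_act g f"
  by (simp add: gl_act_mult gl_act_scalar)

lemma gl_act_uminus: "gl_act g (- f) = - gl_act g f"
  using gl_act_add[of g f "- f"] by (simp add: eq_neg_iff_add_eq_0 add.commute)

lemma gl_act_diff: "gl_act g (f - h) = gl_act g f - gl_act g h"
  using gl_act_add[of g f "- h"] by (simp add: gl_act_uminus)

lemma gl_act_gl_gen:
  fixes g h :: "complex^'n^'n"
  shows "gl_act h (gl_gen g i) = gl_gen (h ** g) i"
proof -
  have "scalar (h $ k $ l * g $ l $ i) * word [k] = scalar (g $ l $ i) * (scalar (h $ k $ l) * word [k])" for k l
    by (simp only: mult.commute[of "h $ k $ l"] scalar_mult mult.assoc)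
  then have "gl_act h (gl_gen g i) = (\<Sum>l\<in>UNIV. \<Sum>k\<in>UNIV. scalar (h $ k $ l * g $ l $ i) * word [k])"
    by (simp add: gl_gen_def[of g] gl_act_sum gl_act_scalar_mult gl_act_word_single gl_gen_def[of h]
        sum_distrib_left)
  also have "\<dots> = (\<Sum>k\<in>UNIV. \<Sum>l\<in>UNIV. scalar (h $ k $ l * g $ l $ i) * word [k])"
    by (rule sum.swap)
  also have "\<dots> = gl_gen (h ** g) i"
  proof -
    have "(scalar (\<Sum>l\<in>A. c l) :: 'n free_alg) = (\<Sum>l\<in>A. scalar (c l))" for c :: "'n \<Rightarrow> complex" and A
      by (induction A rule: infinite_finite_induct) (simp_all add: scalar_add)
    then show ?thesis
      by (simp add: gl_gen_def matrix_matrix_mult_def sum_distrib_right)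
  qed
  finally show ?thesis .
qed

lemma gl_act_gl_act: "gl_act h (gl_act g f) = gl_act (h ** g) f"
proof -
  have "gl_act h (prod_list (map (gl_gen g) w)) = prod_list (map (gl_gen (h ** g)) w)" for w
    by (induction w) (simp_all add: gl_act_1 gl_act_mult gl_act_gl_gen)
  then show ?thesis
    by (simp add: gl_act_def[of g] gl_act_def[of "h ** g"] gl_act_sum gl_act_scalar_mult)
qed

lemma gl_act_mat_1: "gl_act (mat 1) f = f"
proof -
  have "gl_gen (mat 1) i = word [i]" for i :: 'a
  proof -
    have "gl_gen (mat 1) i = (\<Sum>l\<in>UNIV. if l = i then word [l] else 0)"
      unfolding gl_gen_def by (intro sum.cong refl) (simp add: mat_def)
    then show ?thesis by simp
  qed
  then have "prod_list (map (gl_gen (mat 1)) w) = word w" for w :: "'a list"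
    by (induction w) (simp_all add: word_def mult_single plus_list_def zero_list_def
        flip: single_one)
  then have "gl_act (mat 1) f = (\<Sum>w\<in>Poly_Mapping.keys f. Poly_Mapping.single w (Poly_Mapping.lookup f w))"
    by (simp add: gl_act_def word_def scalar_def mult_single plus_list_def)
  then show ?thesis
    by (simp only: free_alg_sum_words[OF finite_keys order_refl, symmetric])
qed

lemma invertible_gl_act_inverse:
  assumes "invertible g"
  obtains h where "\<And>f. gl_act h (gl_act g f) = f" "\<And>f. gl_act g (gl_act h f) = f"
  using assms that unfolding invertible_def by (metis gl_act_gl_act gl_act_mat_1)

lemma gl_act_eq_0_iff:
  assumes "invertible g"
  shows "gl_act g f = 0 \<longleftrightarrow> f = 0"
  using invertible_gl_act_inverse[OF assms] by (metis gl_act_0)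

lemma two_sided_ideal_gl_act_image:
  assumes "two_sided_ideal I" "invertible g"
  shows "two_sided_ideal (gl_act g ` I)"
proof -
  obtain h where h: "\<And>f. gl_act g (gl_act h f) = f"
    using invertible_gl_act_inverse[OF assms(2)] by metis
  have "r * gl_act g x = gl_act g (gl_act h r * x)" "gl_act g x * r = gl_act g (x * gl_act h r)" for r x
    by (simp_all add: gl_act_mult h)
  moreover have "0 = gl_act g 0" by simp
  ultimately show ?thesis
    using assms(1) unfolding two_sided_ideal_def
    by (auto simp: gl_act_add[symmetric] simp del: gl_act_0)
qed


section \<open>Ideals generated by words\<close>

lemma two_sided_ideal_0: "two_sided_ideal I \<Longrightarrow> 0 \<in> I"
  and two_sided_ideal_add: "two_sided_ideal I \<Longrightarrow> x \<in> I \<Longrightarrow> y \<in> I \<Longrightarrow> x + y \<in> I"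
  and two_sided_ideal_mult_left: "two_sided_ideal I \<Longrightarrow> x \<in> I \<Longrightarrow> a * x \<in> I"
  and two_sided_ideal_mult_right: "two_sided_ideal I \<Longrightarrow> x \<in> I \<Longrightarrow> x * a \<in> I"
  by (auto simp: two_sided_ideal_def)

lemma two_sided_ideal_sum:
  "two_sided_ideal I \<Longrightarrow> (\<And>i. i \<in> A \<Longrightarrow> x i \<in> I) \<Longrightarrow> (\<Sum>i\<in>A. x i) \<in> I"
  by (induction A rule: infinite_finite_induct)
    (auto intro: two_sided_ideal_0 two_sided_ideal_add)

lemma two_sided_ideal_diff:
  "two_sided_ideal I \<Longrightarrow> x \<in> I \<Longrightarrow> y \<in> I \<Longrightarrow> x - y \<in> I"
  using two_sided_ideal_add[of I x "- y"] two_sided_ideal_mult_left[of I y "- 1"] by simp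

definition superwords :: "'n list set \<Rightarrow> 'n list set"
  where "superwords B = {u @ w @ v |u w v. w \<in> B}"

lemma superwords_superset: "B \<subseteq> superwords B"
proof
  fix w assume "w \<in> B"
  then show "w \<in> superwords B"
    unfolding superwords_def by (intro CollectI exI[of _ "[]"] exI[of _ w]) simp
qed

lemma superwords_append: "w \<in> superwords B \<Longrightarrow> u @ w @ v \<in> superwords B"
  unfolding superwords_def by clarsimp (metis append.assoc)

lemma superwords_mono: "A \<subseteq> B \<Longrightarrow> superwords A \<subseteq> superwords B"
  unfolding superwords_def by blast

text \<open>Membership in a monomial ideal is decided word by word; this makes it possible to
  compare monomial ideals by comparing sets of words.\<close>

lemma hull_words:
  fixes B :: "'n list set"
  shows "two_sided_ideal hull (word ` B) = {f. Poly_Mapping.keys f \<subseteq> superwords B}"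
proof (rule hull_unique)
  show "word ` B \<subseteq> {f. Poly_Mapping.keys f \<subseteq> superwords B}"
    using superwords_superset[of B] by (auto simp: word_def)
next
  have "r * x \<in> {f. Poly_Mapping.keys f \<subseteq> superwords B} \<and>
      x * r \<in> {f. Poly_Mapping.keys f \<subseteq> superwords B}"
    if "Poly_Mapping.keys x \<subseteq> superwords B" for r x :: "'n free_alg"
  proof (intro conjI CollectI subsetI)
    fix w
    assume "w \<in> Poly_Mapping.keys (r * x)"
    then obtain u v where "v \<in> Poly_Mapping.keys x" "w = u @ v"
      by (rule keys_timesD)
    then show "w \<in> superwords B"
      using superwords_append[of v B u "[]"] that by auto
  next
    fix w
    assume "w \<in> Poly_Mapping.keys (x * r)"
    then obtain u v where "u \<in> Poly_Mapping.keys x" "w = u @ v"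
      by (rule keys_timesD)
    then show "w \<in> superwords B"
      using superwords_append[of u B "[]" v] that by auto
  qed
  moreover have "x + y \<in> {f. Poly_Mapping.keys f \<subseteq> superwords B}"
    if "Poly_Mapping.keys x \<subseteq> superwords B" "Poly_Mapping.keys y \<subseteq> superwords B"
    for x y :: "'n free_alg"
    using that keys_add[of x y] by blast
  ultimately show "two_sided_ideal {f :: 'n free_alg. Poly_Mapping.keys f \<subseteq> superwords B}"
    unfolding two_sided_ideal_def by simp
next
  fix I :: "'n free_alg set"
  assume I: "word ` B \<subseteq> I" "two_sided_ideal I"
  show "{f. Poly_Mapping.keys f \<subseteq> superwords B} \<subseteq> I"
  proof
    fix f :: "'n free_alg"
    assume "f \<in> {f. Poly_Mapping.keys f \<subseteq> superwords B}"
    then have f: "Poly_Mapping.keys f \<subseteq> superwords B" by simp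
    have "Poly_Mapping.single w (Poly_Mapping.lookup f w) \<in> I" if "w \<in> Poly_Mapping.keys f" for w
    proof -
      obtain u b v where w: "w = u @ b @ v" "b \<in> B"
        using f \<open>w \<in> Poly_Mapping.keys f\<close> unfolding superwords_def by blast
      have "Poly_Mapping.single w (Poly_Mapping.lookup f w)
          = Poly_Mapping.single u (Poly_Mapping.lookup f w) * word b * word v"
        by (simp add: word_def mult_single plus_list_def w(1))
      then show ?thesis
        using two_sided_ideal_mult_left[OF I(2)] two_sided_ideal_mult_right[OF I(2)] I(1) w(2) by simp blast
    qed
    then have "(\<Sum>w\<in>Poly_Mapping.keys f. Poly_Mapping.single w (Poly_Mapping.lookup f w)) \<in> I"
      by (rule two_sided_ideal_sum[OF I(2)])
    then show "f \<in> I"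
      by (simp only: free_alg_sum_words[OF finite_keys order_refl, symmetric])
  qed
qed

text \<open>Each of the finitely many words occurring in a finite generating set has a subword in
  \<open>B\<close>. Choosing one such subword for each of them gives the required finite part of \<open>B\<close>.\<close>

lemma fin_gen_word_ideal:
  assumes "fin_gen_ideal (two_sided_ideal hull (word ` B))"
  obtains G where "finite G" "G \<subseteq> B" "superwords G = superwords B"
proof -
  obtain S where S: "finite S" "two_sided_ideal hull (word ` B) = two_sided_ideal hull S"
    using assms unfolding fin_gen_ideal_def by blast
  define K where "K = (\<Union>f\<in>S. Poly_Mapping.keys f)"
  have "S \<subseteq> two_sided_ideal hull (word ` B)"
    unfolding S(2) by (rule hull_subset)
  then have "K \<subseteq> superwords B"
    unfolding hull_words K_def by blast
  then have "\<forall>k\<in>K. \<exists>b\<in>B. k \<in> superwords {b}"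
    unfolding superwords_def by blast
  then obtain b where b: "\<forall>k\<in>K. b k \<in> B \<and> k \<in> superwords {b k}"
    by metis
  have "finite (b ` K)" using S(1) by (simp add: K_def)
  moreover have "b ` K \<subseteq> B" using b by blast
  moreover have "superwords (b ` K) = superwords B"
  proof
    show "superwords (b ` K) \<subseteq> superwords B"
      using \<open>b ` K \<subseteq> B\<close> by (rule superwords_mono)
    have "K \<subseteq> superwords (b ` K)"
      using b superwords_mono[of "{b _}" "b ` K"] by blast
    then have "S \<subseteq> two_sided_ideal hull (word ` b ` K)"
      unfolding hull_words K_def by blast
    then have "two_sided_ideal hull S \<subseteq> two_sided_ideal hull (word ` b ` K)"
      by (intro hull_minimal two_sided_ideal_hull)
    then have sub: "two_sided_ideal hull (word ` B) \<subseteq> two_sided_ideal hull (word ` b ` K)"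
      by (simp only: S(2))
    show "superwords B \<subseteq> superwords (b ` K)"
    proof
      fix w assume "w \<in> superwords B"
      then have "word w \<in> two_sided_ideal hull (word ` B)"
        by (simp add: hull_words) (simp add: word_def)
      with sub have "word w \<in> two_sided_ideal hull (word ` b ` K)" by blast
      then show "w \<in> superwords (b ` K)"
        by (simp add: hull_words) (simp add: word_def)
    qed
  qed
  ultimately show ?thesis using that by blast
qed


section \<open>Leading words\<close>

lemma
  assumes "term_order r"
  shows term_order_refl: "(w, w) \<in> r"
    and term_order_antisym: "(v, w) \<in> r \<Longrightarrow> (w, v) \<in> r \<Longrightarrow> v = w"
    and term_order_total: "(v, w) \<in> r \<or> (w, v) \<in> r"
    and term_order_trans: "(u, v) \<in> r \<Longrightarrow> (v, w) \<in> r \<Longrightarrow> (u, w) \<in> r"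
    and term_order_wf: "wf (r - Id)"
    and term_order_append: "(v, w) \<in> r \<Longrightarrow> (x @ v @ y, x @ w @ y) \<in> r"
proof -
  have r: "refl r" "antisym r" "total r" "trans r" "wf (r - Id)"
    using assms unfolding term_order_def well_order_on_def linear_order_on_def partial_order_on_def
      preorder_on_def by simp_all
  show refl: "(w, w) \<in> r" for w using r(1) by (rule reflD)
  show "(v, w) \<in> r \<Longrightarrow> (w, v) \<in> r \<Longrightarrow> v = w" using r(2) by (rule antisymD)
  show "(v, w) \<in> r \<or> (w, v) \<in> r"
    using r(3) refl[of v] by (cases "v = w") (auto simp: total_on_def)
  show "(u, v) \<in> r \<Longrightarrow> (v, w) \<in> r \<Longrightarrow> (u, w) \<in> r" using r(4) by (rule transD)
  show "wf (r - Id)" by fact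
  show "(v, w) \<in> r \<Longrightarrow> (x @ v @ y, x @ w @ y) \<in> r"
    using assms unfolding term_order_def by simp
qed

lemma finite_term_order_max:
  assumes "term_order r" "finite A" "A \<noteq> {}"
  obtains w where "w \<in> A" "\<And>v. v \<in> A \<Longrightarrow> (v, w) \<in> r"
proof -
  have "\<exists>w\<in>A. \<forall>v\<in>A. (v, w) \<in> r"
    using assms(2,3)
  proof (induction A rule: finite_ne_induct)
    case (singleton x)
    then show ?case using term_order_refl[OF assms(1)] by simp
  next
    case (insert x A)
    then obtain w where "w \<in> A" "\<forall>v\<in>A. (v, w) \<in> r" by blast
    then show ?case
      using term_order_refl[OF assms(1)] term_order_total[OF assms(1), of x w]
        term_order_trans[OF assms(1)] by blast
  qed
  then show ?thesis using that by blast
qed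

lemma lead_word_eqI:
  assumes "term_order r" "w \<in> Poly_Mapping.keys f" "\<And>v. v \<in> Poly_Mapping.keys f \<Longrightarrow> (v, w) \<in> r"
  shows "lead_word r f = w"
  unfolding lead_word_def
proof (rule the_equality)
  show "w \<in> Poly_Mapping.keys f \<and> (\<forall>v\<in>Poly_Mapping.keys f. (v, w) \<in> r)"
    using assms by simp
  show "x = w" if "x \<in> Poly_Mapping.keys f \<and> (\<forall>v\<in>Poly_Mapping.keys f. (v, x) \<in> r)" for x
    using that assms term_order_antisym[OF assms(1), of x w] by simp
qed

lemma
  assumes "term_order r" "f \<noteq> 0"
  shows lead_word_in_keys: "lead_word r f \<in> Poly_Mapping.keys f"
    and keys_le_lead_word: "v \<in> Poly_Mapping.keys f \<Longrightarrow> (v, lead_word r f) \<in> r"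
proof -
  obtain w where "w \<in> Poly_Mapping.keys f" "\<And>v. v \<in> Poly_Mapping.keys f \<Longrightarrow> (v, w) \<in> r"
    using finite_term_order_max[OF assms(1), of "Poly_Mapping.keys f"] assms(2) by auto
  moreover from this have "lead_word r f = w"
    using lead_word_eqI[OF assms(1)] by blast
  ultimately show "lead_word r f \<in> Poly_Mapping.keys f"
    "v \<in> Poly_Mapping.keys f \<Longrightarrow> (v, lead_word r f) \<in> r" by auto
qed

definition lead_words :: "('n list \<times> 'n list) set \<Rightarrow> 'n free_alg set \<Rightarrow> 'n list set"
  where "lead_words r I = {lead_word r f |f. f \<in> I \<and> f \<noteq> 0}"

lemma lead_words_memI: "f \<in> I \<Longrightarrow> f \<noteq> 0 \<Longrightarrow> lead_word r f = w \<Longrightarrow> w \<in> lead_words r I"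
  unfolding lead_words_def by blast

lemma initial_ideal_eq: "initial_ideal r I = two_sided_ideal hull (word ` lead_words r I)"
  unfolding initial_ideal_def lead_words_def by (rule arg_cong[where f = "(hull) _"]) blast

text \<open>Multiplying by words on both sides moves all words of an element in an order-preserving
  way, so it moves the leading word along.\<close>

lemma superwords_lead_words:
  assumes "term_order r" "two_sided_ideal I"
  shows "superwords (lead_words r I) = lead_words r I"
proof
  show "superwords (lead_words r I) \<subseteq> lead_words r I"
  proof
    fix w
    assume "w \<in> superwords (lead_words r I)"
    then obtain u f v where w: "w = u @ lead_word r f @ v" and f: "f \<in> I" "f \<noteq> 0"
      unfolding superwords_def lead_words_def by blast
    let ?h = "word u * (f * word v)"
    have "Poly_Mapping.lookup ?h w = Poly_Mapping.lookup f (lead_word r f)"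
      unfolding w word_def lookup_single_times_append lookup_times_single_append by simp
    then have key: "w \<in> Poly_Mapping.keys ?h"
      using lead_word_in_keys[OF assms(1) f(2)] by (simp add: in_keys_iff)
    have "lead_word r ?h = w"
    proof (rule lead_word_eqI[OF assms(1) key])
      fix x
      assume "x \<in> Poly_Mapping.keys ?h"
      then obtain y where "y \<in> Poly_Mapping.keys f" "x = u @ y @ v"
        by (elim keys_timesD) (auto simp: word_def)
      then show "(x, w) \<in> r"
        unfolding w using keys_le_lead_word[OF assms(1) f(2)] term_order_append[OF assms(1)] by blast
    qed
    moreover have "?h \<in> I"
      using f assms(2) by (intro two_sided_ideal_mult_left two_sided_ideal_mult_right)
    moreover have "?h \<noteq> 0" using key by auto
    ultimately show "w \<in> lead_words r I"
      unfolding lead_words_def by blast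
  qed
qed (rule superwords_superset)


section \<open>Homogeneous components\<close>

definition component :: "nat \<Rightarrow> 'n free_alg \<Rightarrow> 'n free_alg"
  where "component d f =
    (\<Sum>w\<in>{w \<in> Poly_Mapping.keys f. length w = d}. Poly_Mapping.single w (Poly_Mapping.lookup f w))"

lemma lookup_component:
  "Poly_Mapping.lookup (component d f) w = (if length w = d then Poly_Mapping.lookup f w else 0)"
  by (auto simp: component_def lookup_sum lookup_single when_def in_keys_iff)

lemma component_add: "component d (f + h) = component d f + component d h"
  by (rule poly_mapping_eqI) (simp add: lookup_component lookup_add)

lemma component_sum: "component d (\<Sum>i\<in>A. f i) = (\<Sum>i\<in>A. component d (f i))"
  by (rule poly_mapping_eqI) (simp add: lookup_component lookup_sum)

lemma component_homogeneous:
  assumes "\<And>w. w \<in> Poly_Mapping.keys f \<Longrightarrow> length w = e"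
  shows "component d f = (if d = e then f else 0)"
  using assms by (intro poly_mapping_eqI) (auto simp: lookup_component in_keys_iff)

lemma component_single_times:
  "component d (Poly_Mapping.single u c * f)
    = (if length u \<le> d then Poly_Mapping.single u c * component (d - length u) f else 0)"
proof (rule poly_mapping_eqI)
  fix w
  show "Poly_Mapping.lookup (component d (Poly_Mapping.single u c * f)) w = Poly_Mapping.lookup
      (if length u \<le> d then Poly_Mapping.single u c * component (d - length u) f else 0) w"
  proof (cases "\<exists>v. w = u @ v")
    case True
    then show ?thesis
      by (auto simp: lookup_component lookup_single_times_append)
  next
    case False
    then have "Poly_Mapping.lookup (Poly_Mapping.single u c * h) w = 0" for h
      using keys_single_timesD[of w u c h] by (auto simp: in_keys_iff)
    then show ?thesis by (simp add: lookup_component)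
  qed
qed

lemma component_times_single:
  "component d (f * Poly_Mapping.single u c)
    = (if length u \<le> d then component (d - length u) f * Poly_Mapping.single u c else 0)"
proof (rule poly_mapping_eqI)
  fix w
  show "Poly_Mapping.lookup (component d (f * Poly_Mapping.single u c)) w = Poly_Mapping.lookup
      (if length u \<le> d then component (d - length u) f * Poly_Mapping.single u c else 0) w"
  proof (cases "\<exists>v. w = v @ u")
    case True
    then show ?thesis
      by (auto simp: lookup_component lookup_times_single_append)
  next
    case False
    then have "Poly_Mapping.lookup (h * Poly_Mapping.single u c) w = 0" for h
      by (metis in_keys_iff keys_timesD keys_single empty_iff singletonD)
    then show ?thesis by (simp add: lookup_component)
  qed
qed

text \<open>The elements all of whose components lie in \<open>I\<close> form a two-sided ideal, because
  multiplying by one word only shifts degrees. This ideal contains the homogeneous generators of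
  \<open>I\<close>.\<close>

lemma component_in_homogeneous_ideal:
  fixes I :: "'a free_alg set"
  assumes "homogeneous_ideal I" "f \<in> I"
  shows "component d f \<in> I"
proof -
  obtain S where S: "\<And>f. f \<in> S \<Longrightarrow> homogeneous f" "I = two_sided_ideal hull S"
    using assms(1) unfolding homogeneous_ideal_def by blast
  have I: "two_sided_ideal I" unfolding S(2) by (rule two_sided_ideal_hull)
  let ?J = "{f. \<forall>d. component d f \<in> I}"
  have "S \<subseteq> ?J"
  proof
    fix f assume "f \<in> S"
    then have "f \<in> I" using hull_subset[of S two_sided_ideal] S(2) by blast
    moreover obtain e where "\<And>w. w \<in> Poly_Mapping.keys f \<Longrightarrow> length w = e"
      using S(1)[OF \<open>f \<in> S\<close>] unfolding homogeneous_def by blast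
    ultimately show "f \<in> ?J"
      using two_sided_ideal_0[OF I] by (simp add: component_homogeneous[of f e])
  qed
  moreover have "two_sided_ideal ?J"
  proof -
    have "a * f \<in> ?J" "f * a \<in> ?J" if f: "f \<in> ?J" for a f
    proof -
      have a: "a = (\<Sum>w\<in>Poly_Mapping.keys a. Poly_Mapping.single w (Poly_Mapping.lookup a w))"
        by (rule free_alg_sum_words) simp_all
      have "component d (a * f) \<in> I" for d
        using f by (subst a) (auto simp: sum_distrib_right component_sum component_single_times
            intro!: two_sided_ideal_sum two_sided_ideal_mult_left two_sided_ideal_0 I)
      moreover have "component d (f * a) \<in> I" for d
        using f by (subst a) (auto simp: sum_distrib_left component_sum component_times_single
            intro!: two_sided_ideal_sum two_sided_ideal_mult_right two_sided_ideal_0 I)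
      ultimately show "a * f \<in> ?J" "f * a \<in> ?J" by simp_all
    qed
    moreover have "component d (0 :: 'a free_alg) = 0" for d by (simp add: component_def)
    ultimately show ?thesis
      using two_sided_ideal_0[OF I] two_sided_ideal_add[OF I]
      unfolding two_sided_ideal_def by (auto simp: component_add)
  qed
  ultimately have "I \<subseteq> ?J"
    unfolding S(2) by (rule hull_minimal)
  then show ?thesis using assms(2) by blast
qed

lemma component_gl_act: "component d (gl_act g f) = gl_act g (component d f)"
proof -
  have "component d (gl_act g (Poly_Mapping.single w c))
      = gl_act g (component d (Poly_Mapping.single w c))" for w c
  proof -
    have "length v = length w" if "v \<in> Poly_Mapping.keys (gl_act g (Poly_Mapping.single w c))" for v
      using that gl_word_coeff_length[of v w g] by (auto simp: gl_act_single in_keys_iff)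
    then have "component d (gl_act g (Poly_Mapping.single w c))
        = (if d = length w then gl_act g (Poly_Mapping.single w c) else 0)"
      by (rule component_homogeneous)
    moreover have "component d (Poly_Mapping.single w c)
        = (if d = length w then Poly_Mapping.single w c else 0)"
      by (rule component_homogeneous) (auto split: if_splits)
    ultimately show ?thesis by simp
  qed
  then have "component d (gl_act g (\<Sum>w\<in>A. Poly_Mapping.single w (c w)))
      = gl_act g (component d (\<Sum>w\<in>A. Poly_Mapping.single w (c w)))" for A c
    by (simp add: gl_act_sum component_sum)
  from this[of "Poly_Mapping.lookup f" "Poly_Mapping.keys f"] show ?thesis
    by (simp only: free_alg_sum_words[OF finite_keys order_refl, symmetric])
qed

definition degree_part :: "nat \<Rightarrow> 'n free_alg set \<Rightarrow> 'n free_alg set"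
  where "degree_part d I = {f \<in> I. \<forall>w\<in>Poly_Mapping.keys f. length w = d}"

lemma component_in_degree_part:
  assumes "homogeneous_ideal I" "f \<in> I"
  shows "component d f \<in> degree_part d I"
  using component_in_homogeneous_ideal[OF assms]
  by (auto simp: degree_part_def in_keys_iff lookup_component split: if_splits)

lemma degree_part_gl_act_length:
  assumes "f \<in> degree_part d I" "w \<in> Poly_Mapping.keys (gl_act g f)"
  shows "length w = d"
proof -
  have "component d f = f"
    using assms(1) component_homogeneous[of f d d] by (simp add: degree_part_def)
  then have "component d (gl_act g f) = gl_act g f"
    by (simp add: component_gl_act)
  then show ?thesis
    using assms(2) lookup_component[of d "gl_act g f" w] by (auto simp: in_keys_iff split: if_splits)
qed

text \<open>Passing to the component in the degree of the leading word keeps the leading word, and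
  the action commutes with taking components.\<close>

lemma lead_words_degree_part:
  assumes "term_order r" "homogeneous_ideal I"
  shows "lead_words r (gl_act g ` degree_part d I) = {w \<in> lead_words r (gl_act g ` I). length w = d}"
proof (intro set_eqI iffI)
  fix w
  assume "w \<in> lead_words r (gl_act g ` degree_part d I)"
  then obtain f where f: "f \<in> degree_part d I" "gl_act g f \<noteq> 0" "w = lead_word r (gl_act g f)"
    unfolding lead_words_def by blast
  then have "length w = d"
    using degree_part_gl_act_length lead_word_in_keys[OF assms(1)] by blast
  then show "w \<in> {w \<in> lead_words r (gl_act g ` I). length w = d}"
    using f unfolding lead_words_def degree_part_def by blast
next
  fix w
  assume "w \<in> {w \<in> lead_words r (gl_act g ` I). length w = d}"
  then obtain f where f: "f \<in> I" "gl_act g f \<noteq> 0" "w = lead_word r (gl_act g f)" and d: "length w = d"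
    unfolding lead_words_def by blast
  let ?h = "component d (gl_act g f)"
  have key: "w \<in> Poly_Mapping.keys ?h"
    using lead_word_in_keys[OF assms(1) f(2)] d f(3) by (simp add: in_keys_iff lookup_component)
  have "lead_word r ?h = w"
  proof (rule lead_word_eqI[OF assms(1) key])
    fix v
    assume "v \<in> Poly_Mapping.keys ?h"
    then have "v \<in> Poly_Mapping.keys (gl_act g f)"
      by (auto simp: in_keys_iff lookup_component split: if_splits)
    then show "(v, w) \<in> r"
      unfolding f(3) by (rule keys_le_lead_word[OF assms(1) f(2)])
  qed
  moreover have "?h \<in> gl_act g ` degree_part d I"
    using component_in_degree_part[OF assms(2) f(1)] by (auto simp: component_gl_act)
  moreover have "?h \<noteq> 0" using key by auto
  ultimately show "w \<in> lead_words r (gl_act g ` degree_part d I)"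
    unfolding lead_words_def by blast
qed

lemma finite_words_of_length: "finite {w :: 'n::finite list. length w = d}"
  using finite_lists_length_eq[of "UNIV :: 'n set" d] by simp


section \<open>The number of leading words in a degree\<close>

interpretation free_alg: vector_space "\<lambda>c (f :: 'n free_alg). scalar c * f"
  by unfold_locales
    (simp_all add: distrib_left distrib_right scalar_add scalar_mult mult.assoc)

text \<open>In a vanishing combination, the largest leading word that comes with a non-zero
  coefficient could not be cancelled by the other terms.\<close>

lemma independent_if_distinct_lead_words:
  fixes S :: "'n::finite free_alg set"
  assumes r: "term_order r"
    and nonzero: "\<And>x. x \<in> S \<Longrightarrow> gl_act g x \<noteq> 0"
    and inj: "inj_on (\<lambda>x. lead_word r (gl_act g x)) S"
  shows "free_alg.independent S"
proof
  let ?lead = "\<lambda>x. lead_word r (gl_act g x)"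
  assume "free_alg.dependent S"
  then obtain T c where T: "finite T" "T \<subseteq> S" and sum: "(\<Sum>x\<in>T. scalar (c x) * x) = 0"
    and "\<exists>x\<in>T. c x \<noteq> 0"
    unfolding free_alg.dependent_explicit by blast
  then have "finite (?lead ` {x \<in> T. c x \<noteq> 0})" "?lead ` {x \<in> T. c x \<noteq> 0} \<noteq> {}"
    by auto
  then obtain w where w: "w \<in> ?lead ` {x \<in> T. c x \<noteq> 0}"
    and max: "\<And>v. v \<in> ?lead ` {x \<in> T. c x \<noteq> 0} \<Longrightarrow> (v, w) \<in> r"
    by (rule finite_term_order_max[OF r]) blast
  obtain y where y: "y \<in> T" "c y \<noteq> 0" "w = ?lead y" using w by blast
  have others: "c x * Poly_Mapping.lookup (gl_act g x) w = 0" if x: "x \<in> T - {y}" for x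
  proof (rule ccontr)
    assume *: "c x * Poly_Mapping.lookup (gl_act g x) w \<noteq> 0"
    then have "(w, ?lead x) \<in> r"
      using x T nonzero by (intro keys_le_lead_word[OF r]) (auto simp: in_keys_iff)
    moreover have "(?lead x, w) \<in> r" using * x by (intro max) auto
    ultimately have "?lead x = ?lead y"
      using term_order_antisym[OF r] y(3) by blast
    then show False using inj x y(1) T(2) unfolding inj_on_def by blast
  qed
  have "(\<Sum>x\<in>T. c x * Poly_Mapping.lookup (gl_act g x) w)
      = c y * Poly_Mapping.lookup (gl_act g y) w"
    using others by (subst sum.remove[OF T(1) y(1)]) (simp add: sum.neutral del: mult_eq_0_iff)
  moreover have "(\<Sum>x\<in>T. c x * Poly_Mapping.lookup (gl_act g x) w)
      = Poly_Mapping.lookup (gl_act g (\<Sum>x\<in>T. scalar (c x) * x)) w"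
    by (simp add: gl_act_sum lookup_sum gl_act_scalar_mult)
  moreover have "Poly_Mapping.lookup (gl_act g y) w \<noteq> 0"
    using lead_word_in_keys[OF r, of "gl_act g y"] nonzero y T by (auto simp: in_keys_iff)
  ultimately show False using sum y(2) by simp
qed

text \<open>Subtracting a multiple of an element with the same leading word lowers the leading word,
  and the term order is well-founded. Elements are compared after applying \<open>h\<close> but spanned before,
  which is what allows different matrices to be compared inside one and the same space.\<close>

lemma span_if_all_lead_words:
  fixes J Y :: "'n::finite free_alg set"
  assumes r: "term_order r" and h: "invertible h"
    and J: "\<And>x y c. x \<in> J \<Longrightarrow> y \<in> J \<Longrightarrow> x - scalar c * y \<in> J" and "Y \<subseteq> J"
    and leads: "\<And>x. x \<in> J \<Longrightarrow> x \<noteq> 0 \<Longrightarrow>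
      \<exists>y\<in>Y. y \<noteq> 0 \<and> lead_word r (gl_act h y) = lead_word r (gl_act h x)"
  shows "J \<subseteq> free_alg.span Y"
proof
  have "x \<in> free_alg.span Y" if "x \<in> J" "x \<noteq> 0" "lead_word r (gl_act h x) = w" for x w
    using that
  proof (induction w arbitrary: x rule: wf_induct_rule[OF term_order_wf[OF r]])
    case (1 w)
    obtain y where y: "y \<in> Y" "y \<noteq> 0" "lead_word r (gl_act h y) = w"
      using leads 1 by blast
    have nz: "gl_act h x \<noteq> 0" "gl_act h y \<noteq> 0"
      using gl_act_eq_0_iff[OF h] 1 y by auto
    define c where "c = Poly_Mapping.lookup (gl_act h x) w / Poly_Mapping.lookup (gl_act h y) w"
    define x' where "x' = x - scalar c * y"
    have act: "Poly_Mapping.lookup (gl_act h x') v =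
        Poly_Mapping.lookup (gl_act h x) v - c * Poly_Mapping.lookup (gl_act h y) v" for v
      by (simp add: x'_def gl_act_diff gl_act_scalar_mult lookup_minus)
    have "x' \<in> free_alg.span Y"
    proof (cases "x' = 0")
      case True
      then show ?thesis by (simp add: free_alg.span_zero)
    next
      case False
      then have nz': "gl_act h x' \<noteq> 0" using gl_act_eq_0_iff[OF h] by blast
      let ?v = "lead_word r (gl_act h x')"
      have key: "?v \<in> Poly_Mapping.keys (gl_act h x')"
        by (rule lead_word_in_keys[OF r nz'])
      then have "?v \<in> Poly_Mapping.keys (gl_act h x) \<or> ?v \<in> Poly_Mapping.keys (gl_act h y)"
        by (auto simp: in_keys_iff act)
      then have "(?v, w) \<in> r"
        using keys_le_lead_word[OF r nz(1), of ?v] keys_le_lead_word[OF r nz(2), of ?v] 1(4) y(3)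
        by auto
      moreover have "w \<in> Poly_Mapping.keys (gl_act h y)"
        using lead_word_in_keys[OF r nz(2)] y(3) by simp
      then have "?v \<noteq> w"
        using key by (auto simp: in_keys_iff act c_def)
      moreover have "x' \<in> J"
        unfolding x'_def using J 1(2) y(1) \<open>Y \<subseteq> J\<close> by blast
      ultimately show ?thesis
        using "1.IH"[of ?v x'] False by simp
    qed
    then have "x' + scalar c * y \<in> free_alg.span Y"
      by (rule free_alg.span_add[OF _ free_alg.span_scale[OF free_alg.span_base[OF y(1)]]])
    then show ?case by (simp add: x'_def)
  qed
  then show "x \<in> free_alg.span Y" if "x \<in> J" for x
    using that by (cases "x = 0") (auto simp: free_alg.span_zero)
qed

lemma degree_part_diff_scalar:
  assumes "two_sided_ideal I" "x \<in> degree_part d I" "y \<in> degree_part d I"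
  shows "scalar a * x - scalar b * y \<in> degree_part d I"
proof -
  have "scalar a * x - scalar b * y \<in> I"
    using assms by (intro two_sided_ideal_diff two_sided_ideal_mult_left) (auto simp: degree_part_def)
  moreover have "length w = d" if "w \<in> Poly_Mapping.keys (scalar a * x - scalar b * y)" for w
  proof -
    have "w \<in> Poly_Mapping.keys x \<or> w \<in> Poly_Mapping.keys y"
      using that by (auto simp: in_keys_iff lookup_minus)
    then show ?thesis using assms unfolding degree_part_def by blast
  qed
  ultimately show ?thesis by (simp add: degree_part_def)
qed

lemma finite_lead_words_degree_part:
  fixes I :: "'n::finite free_alg set"
  assumes "term_order r"
  shows "finite (lead_words r (gl_act g ` degree_part d I))"
proof (rule finite_subset[OF _ finite_words_of_length])
  show "lead_words r (gl_act g ` degree_part d I) \<subseteq> {w. length w = d}"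
    using degree_part_gl_act_length lead_word_in_keys[OF assms] unfolding lead_words_def by blast
qed

text \<open>Preimages of elements with the leading words on the left are independent in the degree
  part of \<open>I\<close>, and preimages of those on the right span it. If both matrices are invertible, the
  inequality holds in both directions.\<close>

lemma card_lead_words_le:
  fixes I :: "'n::finite free_alg set"
  assumes r: "term_order r" and I: "two_sided_ideal I" and h: "invertible h"
  shows "card (lead_words r (gl_act g ` degree_part d I))
    \<le> card (lead_words r (gl_act h ` degree_part d I))"
proof -
  let ?J = "degree_part d I"
  let ?L = "\<lambda>g. lead_words r (gl_act g ` ?J)"
  have "\<forall>w\<in>?L g. \<exists>x. x \<in> ?J \<and> gl_act g x \<noteq> 0 \<and> lead_word r (gl_act g x) = w" for g
    unfolding lead_words_def by blast
  from bchoice[OF this[of g]] bchoice[OF this[of h]] obtain x y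
    where x: "\<And>w. w \<in> ?L g \<Longrightarrow> x w \<in> ?J \<and> gl_act g (x w) \<noteq> 0 \<and> lead_word r (gl_act g (x w)) = w"
      and y: "\<And>w. w \<in> ?L h \<Longrightarrow> y w \<in> ?J \<and> gl_act h (y w) \<noteq> 0 \<and> lead_word r (gl_act h (y w)) = w"
    by blast
  have "free_alg.independent (x ` ?L g)"
    using x by (intro independent_if_distinct_lead_words[OF r, of _ g]) (auto simp: inj_on_def)
  moreover have "?J \<subseteq> free_alg.span (y ` ?L h)"
  proof (rule span_if_all_lead_words[OF r h])
    show "u - scalar c * v \<in> ?J" if "u \<in> ?J" "v \<in> ?J" for u v c
      using degree_part_diff_scalar[OF I that, of 1 c] by simp
    show "y ` ?L h \<subseteq> ?J" using y by blast
    fix u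
    assume "u \<in> ?J" "u \<noteq> 0"
    then have w: "lead_word r (gl_act h u) \<in> ?L h"
      using gl_act_eq_0_iff[OF h] unfolding lead_words_def by blast
    then show "\<exists>v\<in>y ` ?L h. v \<noteq> 0 \<and> lead_word r (gl_act h v) = lead_word r (gl_act h u)"
      using y[OF w] by (intro bexI[of _ "y (lead_word r (gl_act h u))"]) auto
  qed
  moreover have "x ` ?L g \<subseteq> ?J" using x by blast
  ultimately have "card (x ` ?L g) \<le> card (y ` ?L h)"
    using free_alg.independent_span_bound[of "y ` ?L h" "x ` ?L g"] finite_lead_words_degree_part[OF r, of h d I]
    by auto
  also have "\<dots> \<le> card (?L h)"
    by (rule card_image_le) (rule finite_lead_words_degree_part[OF r])
  also have "card (x ` ?L g) = card (?L g)"
    by (rule card_image) (metis inj_onI x)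
  finally show ?thesis .
qed


section \<open>Generic leading words\<close>

text \<open>Elements of the degree \<open>d\<close> part of \<open>g(I)\<close> that depend polynomially on \<open>g\<close>. Besides
  \<open>\<lambda>g. gl_act g f\<close> for fixed \<open>f\<close> this includes combinations whose scalars are polynomials in \<open>g\<close>,
  as they arise during Gaussian elimination without division.\<close>

definition polynomial_families :: "'n::finite free_alg set \<Rightarrow> nat \<Rightarrow> (complex^'n^'n \<Rightarrow> 'n free_alg) set"
  where "polynomial_families I d = {m.
    (\<forall>w. (\<lambda>g. Poly_Mapping.lookup (m g) w) \<in> matrix_poly) \<and> (\<forall>g. m g \<in> gl_act g ` degree_part d I)}"

definition generic_lead ::
    "('n list \<times> 'n list) set \<Rightarrow> (complex^'n^'n \<Rightarrow> 'n free_alg) \<Rightarrow> 'n::finite list \<Rightarrow> bool"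
  where "generic_lead r m w \<longleftrightarrow> (\<exists>g. Poly_Mapping.lookup (m g) w \<noteq> 0) \<and>
    (\<forall>v g. Poly_Mapping.lookup (m g) v \<noteq> 0 \<longrightarrow> (v, w) \<in> r)"

definition generic_words :: "('n list \<times> 'n list) set \<Rightarrow> 'n::finite free_alg set \<Rightarrow> 'n list set"
  where "generic_words r I = {w. \<exists>m\<in>polynomial_families I (length w). generic_lead r m w}"

lemma lead_word_of_generic_lead:
  assumes "term_order r" "generic_lead r m w" "Poly_Mapping.lookup (m g) w \<noteq> 0"
  shows "lead_word r (m g) = w"
  using assms by (intro lead_word_eqI) (auto simp: generic_lead_def in_keys_iff)

lemma polynomial_family_length:
  assumes "m \<in> polynomial_families I d" "Poly_Mapping.lookup (m g) w \<noteq> 0"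
  shows "length w = d"
proof -
  obtain f where "f \<in> degree_part d I" "m g = gl_act g f"
    using assms(1) unfolding polynomial_families_def by blast
  then show ?thesis
    using degree_part_gl_act_length[of f d I w g] assms(2) by (simp add: in_keys_iff)
qed

lemma generic_lead_exists:
  fixes I :: "'n::finite free_alg set"
  assumes "term_order r" "m \<in> polynomial_families I d" "m h \<noteq> 0"
  obtains w where "generic_lead r m w"
proof -
  let ?A = "{w. \<exists>g. Poly_Mapping.lookup (m g) w \<noteq> 0}"
  have "finite ?A"
    using polynomial_family_length[OF assms(2)]
    by (intro finite_subset[OF _ finite_words_of_length[of d]]) blast
  moreover have "?A \<noteq> {}"
    using assms(3) poly_mapping_eqI[of "m h" 0] by auto
  ultimately obtain w where "w \<in> ?A" "\<And>v. v \<in> ?A \<Longrightarrow> (v, w) \<in> r"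
    by (rule finite_term_order_max[OF assms(1)]) blast
  then show ?thesis using that unfolding generic_lead_def by blast
qed

text \<open>An elimination step has this form; its scalars are coefficients of the families involved.\<close>

lemma polynomial_families_combine:
  assumes I: "two_sided_ideal I" and m: "m \<in> polynomial_families I d" "k \<in> polynomial_families I d"
    and p: "p \<in> matrix_poly" "q \<in> matrix_poly"
  shows "(\<lambda>g. scalar (p g) * m g - scalar (q g) * k g) \<in> polynomial_families I d"
  unfolding polynomial_families_def
proof (intro CollectI conjI allI)
  fix w
  have "(\<lambda>g. p g * Poly_Mapping.lookup (m g) w + (- 1) * (q g * Poly_Mapping.lookup (k g) w))
      \<in> matrix_poly"
    using m unfolding polynomial_families_def
    by (intro matrix_poly.add matrix_poly.mult matrix_poly.const p) auto
  then show "(\<lambda>g. Poly_Mapping.lookup (scalar (p g) * m g - scalar (q g) * k g) w) \<in> matrix_poly"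
    by (simp add: lookup_minus)
next
  fix g
  obtain x y where "x \<in> degree_part d I" "y \<in> degree_part d I" "m g = gl_act g x" "k g = gl_act g y"
    using m unfolding polynomial_families_def by blast
  then show "scalar (p g) * m g - scalar (q g) * k g \<in> gl_act g ` degree_part d I"
    using degree_part_diff_scalar[OF I, of x d y "p g" "q g"]
    by (intro image_eqI[of _ _ "scalar (p g) * x - scalar (q g) * y"])
      (simp_all add: gl_act_diff gl_act_scalar_mult)
qed

text \<open>If the generic leading coefficient of a family happens to vanish at \<open>h\<close>, one
  elimination step with the chosen family \<open>m v\<close> lowers the generic leading word without changing the
  value at \<open>h\<close>. Well-foundedness makes this stop, at a family whose generic leading word is the
  leading word of its value at \<open>h\<close>.\<close>

lemma lead_words_at_generic_point:
  fixes I :: "'n::finite free_alg set"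
  assumes r: "term_order r" and I: "two_sided_ideal I"
    and m: "\<And>w. w \<in> generic_words r I \<Longrightarrow> length w = d \<Longrightarrow>
      m w \<in> polynomial_families I d \<and> generic_lead r (m w) w \<and> Poly_Mapping.lookup (m w h) w \<noteq> 0"
  shows "lead_words r (gl_act h ` degree_part d I) = {w \<in> generic_words r I. length w = d}"
    (is "_ = ?B")
proof
  show "?B \<subseteq> lead_words r (gl_act h ` degree_part d I)"
  proof
    fix w assume "w \<in> ?B"
    then have w: "m w \<in> polynomial_families I d" "generic_lead r (m w) w"
      "Poly_Mapping.lookup (m w h) w \<noteq> 0" using m by auto
    then have "lead_word r (m w h) = w" "m w h \<in> gl_act h ` degree_part d I" "m w h \<noteq> 0"
      using lead_word_of_generic_lead[OF r] by (auto simp: polynomial_families_def)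
    then show "w \<in> lead_words r (gl_act h ` degree_part d I)"
      by (intro lead_words_memI)
  qed
next
  have step: "lead_word r (k h) \<in> ?B"
    if "k \<in> polynomial_families I d" "generic_lead r k v" "k h \<noteq> 0" for k v
    using that
  proof (induction v arbitrary: k rule: wf_induct_rule[OF term_order_wf[OF r]])
    case (1 v)
    have len: "length v = d"
      using 1(3) polynomial_family_length[OF 1(2)] unfolding generic_lead_def by blast
    have v: "v \<in> generic_words r I"
      using 1(2,3) len unfolding generic_words_def by blast
    show ?case
    proof (cases "Poly_Mapping.lookup (k h) v = 0")
      case False
      then show ?thesis
        using lead_word_of_generic_lead[OF r 1(3)] v len by simp
    next
      case True
      define c where "c = Poly_Mapping.lookup (m v h) v"
      have mv: "m v \<in> polynomial_families I d" "generic_lead r (m v) v" "c \<noteq> 0"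
        using m[OF v len] by (auto simp: c_def)
      \<comment> \<open>Cross-multiplication cancels the coefficient at \<open>v\<close> identically in \<open>g\<close>. At \<open>h\<close> the first
        scalar is 1 and the second is 0, so the value there is kept.\<close>
      define k' where "k' g = scalar (inverse c * Poly_Mapping.lookup (m v g) v) * k g
        - scalar (inverse c * Poly_Mapping.lookup (k g) v) * m v g" for g
      have k': "k' \<in> polynomial_families I d"
        unfolding k'_def[abs_def] using 1(2) mv(1)
        by (intro polynomial_families_combine I matrix_poly.mult matrix_poly.const)
          (auto simp: polynomial_families_def)
      have k'h: "k' h = k h"
        using True mv(3) by (simp add: k'_def c_def[symmetric])
      then obtain u where u: "generic_lead r k' u"
        using generic_lead_exists[OF r k', of h] 1(4) by auto
      then obtain g where g: "Poly_Mapping.lookup (k' g) u \<noteq> 0"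
        unfolding generic_lead_def by blast
      then have "u \<noteq> v"
        by (auto simp: k'_def lookup_minus)
      moreover have "Poly_Mapping.lookup (k g) u \<noteq> 0 \<or> Poly_Mapping.lookup (m v g) u \<noteq> 0"
        using g by (auto simp: k'_def lookup_minus)
      then have "(u, v) \<in> r"
        using 1(3) mv(2) unfolding generic_lead_def by blast
      ultimately show ?thesis
        using "1.IH"[of u k'] k' u k'h 1(4) by simp
    qed
  qed
  show "lead_words r (gl_act h ` degree_part d I) \<subseteq> ?B"
  proof
    fix w
    assume "w \<in> lead_words r (gl_act h ` degree_part d I)"
    then obtain f where f: "f \<in> degree_part d I" "gl_act h f \<noteq> 0" "w = lead_word r (gl_act h f)"
      unfolding lead_words_def by blast
    have fam: "(\<lambda>g. gl_act g f) \<in> polynomial_families I d"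
      using f(1) gl_act_coeff_matrix_poly unfolding polynomial_families_def by blast
    obtain v where "generic_lead r (\<lambda>g. gl_act g f) v"
      using generic_lead_exists[OF r fam, of h] f(2) by blast
    from step[OF fam this] show "w \<in> ?B" using f(2,3) by simp
  qed
qed


section \<open>The generic initial ideal\<close>

theorem theorem3p1:
  fixes \<aa> :: "'n::finite free_alg set" and r :: "('n list \<times> 'n list) set"
  assumes "two_sided_ideal \<aa>" and "homogeneous_ideal \<aa>" and "term_order r"
  shows "\<exists>\<bb> U. monomial_ideal \<bb> \<and> F_delta U \<and>
    (\<forall>g\<in>U. initial_ideal r (gl_act g ` \<aa>) = \<bb>) \<and>
    (fin_gen_ideal \<bb> \<longrightarrow> openin zariski_GL U)"
proof -
  note I = assms(1) and hom = assms(2) and r = assms(3)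
  define B where "B = generic_words r \<aa>"
  let ?\<bb> = "two_sided_ideal hull (word ` B) :: 'n free_alg set"
  have "\<forall>w\<in>B. \<exists>m. m \<in> polynomial_families \<aa> (length w) \<and> generic_lead r m w"
    unfolding B_def generic_words_def by blast
  then obtain m where m: "\<And>w. w \<in> B \<Longrightarrow> m w \<in> polynomial_families \<aa> (length w) \<and> generic_lead r (m w) w"
    by metis
  define c where "c w g = Poly_Mapping.lookup (m w g) w" for w g
  have c_poly: "c w \<in> matrix_poly" and c_nonzero: "\<exists>g. c w g \<noteq> 0" if "w \<in> B" for w
    using m[OF that] unfolding c_def[abs_def] polynomial_families_def generic_lead_def by blast+
  \<comment> \<open>Only the coefficients at words of \<open>G\<close> enter \<open>U\<close>, so \<open>G\<close> is chosen finite if possible.\<close>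
  obtain G where G: "G \<subseteq> B" "superwords G = superwords B" "fin_gen_ideal ?\<bb> \<Longrightarrow> finite G"
  proof (cases "fin_gen_ideal ?\<bb>")
    case True
    then show ?thesis using that fin_gen_word_ideal by metis
  next
    case False
    then show ?thesis using that[of B] by simp
  qed
  define U where "U = {g. invertible g \<and> (\<forall>w\<in>G. c w g \<noteq> 0)}"
  have leads: "lead_words r (gl_act g ` \<aa>) = B" if "g \<in> U" for g
  proof -
    let ?L = "lead_words r (gl_act g ` \<aa>)"
    have g: "invertible g" "\<And>w. w \<in> G \<Longrightarrow> c w g \<noteq> 0"
      using that by (auto simp: U_def)
    have "G \<subseteq> ?L"
    proof
      fix w assume "w \<in> G"
      then have w: "m w \<in> polynomial_families \<aa> (length w)" "generic_lead r (m w) w"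
        "Poly_Mapping.lookup (m w g) w \<noteq> 0"
        using G(1) m g(2) by (auto simp: c_def)
      then have "lead_word r (m w g) = w" "m w g \<in> gl_act g ` \<aa>" "m w g \<noteq> 0"
        using lead_word_of_generic_lead[OF r] by (auto simp: polynomial_families_def degree_part_def)
      then show "w \<in> ?L" by (intro lead_words_memI)
    qed
    then have "superwords G \<subseteq> ?L"
      using superwords_mono superwords_lead_words[OF r two_sided_ideal_gl_act_image[OF I g(1)]]
      by blast
    then have sub: "B \<subseteq> ?L"
      using superwords_superset G(2) by blast
    \<comment> \<open>In each degree, compare with an invertible \<open>h\<close> at which no \<open>c w\<close> of that degree vanishes.\<close>
    have "{w \<in> B. length w = d} = {w \<in> ?L. length w = d}" for d
    proof (rule card_seteq)
      have fin: "finite {w \<in> B. length w = d}"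
        by (rule finite_subset[OF _ finite_words_of_length[of d]]) blast
      show "finite {w \<in> ?L. length w = d}"
        by (rule finite_subset[OF _ finite_words_of_length[of d]]) blast
      show "{w \<in> B. length w = d} \<subseteq> {w \<in> ?L. length w = d}" using sub by blast
      obtain h where h: "invertible h" "\<And>w. w \<in> B \<Longrightarrow> length w = d \<Longrightarrow> c w h \<noteq> 0"
        using finitely_many_matrix_polys_nonzero[OF fin, of c] c_poly c_nonzero by auto
      have "lead_words r (gl_act h ` degree_part d \<aa>) = {w \<in> B. length w = d}"
        using m h(2) unfolding B_def c_def by (intro lead_words_at_generic_point[where m = m, OF r I]) auto
      then show "card {w \<in> ?L. length w = d} \<le> card {w \<in> B. length w = d}"
        using card_lead_words_le[OF r I h(1), of g d] by (simp add: lead_words_degree_part[OF r hom])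
    qed
    then show ?thesis by blast
  qed
  have "F_delta U"
    unfolding F_delta_def
  proof (intro exI conjI allI)
    \<comment> \<open>The intersection runs over all words, as enumerated by \<open>from_nat\<close>; a word outside \<open>G\<close>
      contributes the whole general linear group.\<close>
    let ?p = "\<lambda>w g. if w \<in> G then c w g else 1"
    have poly: "?p w \<in> matrix_poly" for w
      using c_poly G(1) by (cases "w \<in> G") (auto intro: matrix_poly.const)
    fix k :: nat
    show "openin zariski_GL {g. invertible g \<and> ?p (from_nat k) g \<noteq> 0}"
      by (rule openin_zariski_GL_nonzero[OF poly])
    have "\<exists>g. ?p (from_nat k) g \<noteq> 0"
      using c_nonzero G(1) by (cases "from_nat k \<in> G") auto
    then have "\<exists>g. invertible g \<and> (\<forall>w\<in>{from_nat k}. ?p w g \<noteq> 0)"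
      by (intro finitely_many_matrix_polys_nonzero poly) auto
    then show "{g. invertible g \<and> ?p (from_nat k) g \<noteq> 0} \<noteq> {}"
      by auto
  next
    show "U = (\<Inter>k. {g. invertible g \<and> (if from_nat k \<in> G then c (from_nat k) g else 1) \<noteq> 0})"
      unfolding U_def by (auto split: if_splits) (metis from_nat_to_nat)
  qed
  moreover have "openin zariski_GL U" if "fin_gen_ideal ?\<bb>"
  proof -
    have "U = {g. invertible g \<and> (\<Prod>w\<in>G. c w g) \<noteq> 0}"
      using G(3)[OF that] by (auto simp: U_def)
    then show ?thesis
      using c_poly G(1) by (auto intro!: openin_zariski_GL_nonzero matrix_poly_prod)
  qed
  moreover have "monomial_ideal ?\<bb>"
    unfolding monomial_ideal_def by blast
  moreover have "initial_ideal r (gl_act g ` \<aa>) = ?\<bb>" if "g \<in> U" for g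
    using leads[OF that] by (simp add: initial_ideal_eq)
  ultimately show ?thesis
    by (intro exI[of _ ?\<bb>] exI[of _ U]) simp
qed

end
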